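(* Let $\{X_n\}$ be a Harris recurrent Markov chain on $\mathscr{X}$ that is $\psi$-irreducible and aperiodic. Then $\{X_n\}$ is non-geometrically ergodic (i.e. not geometrically ergodic) if there exist a set $A\in\mathscr{B}^+(\mathscr{X})$, a sequence of numbers $\{r_n\}_{n\ge1}$ with $r_n>1$, and a sequence of functions $V^{(n)}:\mathscr{X}\to\mathbb{R}$, $n\ge1$, satisfying: (1) $\lim_{n\to\infty}r_n=1$; (2) for all $n\ge1$, $V^{(n)}$ is compactly supported, bounded on any compact set, and satisfies $$V^{(n)}(x)\le r_n\int_{A^c}V^{(n)}(y)P(x,\mathrm{d}y)+1\quad\text{for all }x\in\mathscr{X};$$ (3) $\{x:\sup_{n\ge1}V^{(n)}(x)=\infty\}\in\mathscr{B}^+(\mathscr{X})$.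
   Context: $\mathscr{X}$ is a locally compact separable metric space with a countably generated $\sigma$-field $\mathscr{B}(\mathscr{X})$. $\{X_n\}_{n\ge0}$ is a homogeneous Markov chain on $\mathscr{X}$ with $n$-step kernels $P^n(x,A)=\mathbb{P}(X_n\in A\mid X_0=x)$ and $P=P^1$. The chain is $\psi$-irreducible if there is a $\sigma$-finite measure $\psi$ on $(\mathscr{X},\mathscr{B}(\mathscr{X}))$ such that $\sum_{n\ge1}P^n(x,A)>0$ for all $x\in\mathscr{X}$ whenever $\psi(A)>0$; throughout, $\psi$ is a maximal irreducibility measure (every irreducibility measure is absolutely continuous with respect to $\psi$), and $\mathscr{B}^+(\mathscr{X})=\{A\in\mathscr{B}(\mathscr{X}):\psi(A)>0\}$. Aperiodic has the standard meaning of Meyn-Tweedie. Functions are $\mathscr{B}(\mathscr{X})$-measurable. A set $C\in\mathscr{B}(\mathscr{X})$ is petite if there are a probability distribution $\{a_n\}$ on $\mathbb{Z}_+$ and a non-trivial measure $\nu_a$ on $\mathscr{B}(\mathscr{X})$ with $\sum_{n\ge0}a_nP^n(x,B)\ge\nu_a(B)$ for all $x\in C$, $B\in\mathscr{B}(\mathscr{X})$. $\tau_A^+=\inf\{n\ge1:X_n\in A\}$. Harris recurrent: $\mathbb{P}_x(\sum_{n\ge1}\mathbf{1}_{\{X_n\in A\}}=\infty)=1$ for all $x\in\mathscr{X}$, $A\in\mathscr{B}^+(\mathscr{X})$. Geometrically ergodic: there are a nonempty petite set $C\in\mathscr{B}(\mathscr{X})$ and $r>1$ with $\sup_{x\in C}\mathbb{E}_x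 r^{\tau_C^+}<\infty$. *)

theory Defs
  imports "HOL-Probability.Probability"
begin

definition countably_generated_sigma_field :: "'a measure \<Rightarrow> bool" where
  "countably_generated_sigma_field M \<longleftrightarrow>
     (\<exists>G. countable G \<and> G \<subseteq> Pow (space M) \<and> sets M = sigma_sets (space M) G)"

text \<open>
  A chain on the measurable space \<open>M\<close> is a family of random variables \<open>X n\<close> on a measurable
  space \<open>\<Omega>\<close> together with the laws \<open>Pr x\<close> on \<open>\<Omega>\<close> of the chain started at \<open>x\<close>. No particular
  realisation, such as the canonical path space, is fixed.
  In \<open>M\<close>, \<open>\<Omega>\<close> only the carrier and the sigma-field matter.
\<close>

definition nstep_kernel :: "'a measure \<Rightarrow> ('a \<Rightarrow> 'w measure) \<Rightarrow> (nat \<Rightarrow> 'w \<Rightarrow> 'a) \<Rightarrow> nat \<Rightarrow> 'a \<Rightarrow> 'a measure" where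
  "nstep_kernel M Pr X n x = distr (Pr x) M (X n)"

definition history :: "'a measure \<Rightarrow> 'w measure \<Rightarrow> (nat \<Rightarrow> 'w \<Rightarrow> 'a) \<Rightarrow> nat \<Rightarrow> 'w measure" where
  "history M \<Omega> X n =
     vimage_algebra (space \<Omega>) (\<lambda>\<omega>. \<lambda>i\<in>{..n}. X i \<omega>) (PiM {..n} (\<lambda>_. M))"

definition markov_chain ::
  "'a measure \<Rightarrow> 'w measure \<Rightarrow> ('a \<Rightarrow> 'w measure) \<Rightarrow> (nat \<Rightarrow> 'w \<Rightarrow> 'a) \<Rightarrow> bool" where
  "markov_chain M \<Omega> Pr X \<longleftrightarrow>
     (\<forall>n. X n \<in> measurable \<Omega> M) \<and>
     (\<forall>x\<in>space M. prob_space (Pr x) \<and> sets (Pr x) = sets \<Omega> \<and> distr (Pr x) M (X 0) = return M x) \<and>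
     nstep_kernel M Pr X 1 \<in> measurable M (prob_algebra M) \<and>
     (\<forall>x\<in>space M. \<forall>n. \<forall>A\<in>sets M.
        AE \<omega> in Pr x.
          real_cond_exp (Pr x) (history M \<Omega> X n) (\<lambda>\<omega>'. indicator A (X (Suc n) \<omega>')) \<omega> =
          measure (nstep_kernel M Pr X 1 (X n \<omega>)) A)"

definition irreducibility_measure ::
  "'a measure \<Rightarrow> ('a \<Rightarrow> 'w measure) \<Rightarrow> (nat \<Rightarrow> 'w \<Rightarrow> 'a) \<Rightarrow> 'a measure \<Rightarrow> bool" where
  "irreducibility_measure M Pr X \<phi> \<longleftrightarrow>
     sets \<phi> = sets M \<and> sigma_finite_measure \<phi> \<and>
     (\<forall>A\<in>sets M. emeasure \<phi> A > 0 \<longrightarrow>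
        (\<forall>x\<in>space M. (\<Sum>n. emeasure (nstep_kernel M Pr X (Suc n) x) A) > 0))"

definition maximal_irreducibility_measure ::
  "'a measure \<Rightarrow> ('a \<Rightarrow> 'w measure) \<Rightarrow> (nat \<Rightarrow> 'w \<Rightarrow> 'a) \<Rightarrow> 'a measure \<Rightarrow> bool" where
  "maximal_irreducibility_measure M Pr X \<psi> \<longleftrightarrow>
     irreducibility_measure M Pr X \<psi> \<and>
     (\<forall>\<phi>. irreducibility_measure M Pr X \<phi> \<longrightarrow> absolutely_continuous \<psi> \<phi>)"

definition Bplus :: "'a measure \<Rightarrow> 'a measure \<Rightarrow> 'a set set" where
  "Bplus M \<psi> = {A \<in> sets M. emeasure \<psi> A > 0}"

text \<open>
  Meyn and Tweedie define the period as the largest \<open>d\<close> for which a \<open>d\<close>-cycle exists, and call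
  the chain aperiodic if the period is \<open>1\<close>. The whole space is always a \<open>1\<close>-cycle.
\<close>

definition d_cycle ::
  "'a measure \<Rightarrow> ('a \<Rightarrow> 'w measure) \<Rightarrow> (nat \<Rightarrow> 'w \<Rightarrow> 'a) \<Rightarrow> 'a measure \<Rightarrow> nat \<Rightarrow> (nat \<Rightarrow> 'a set) \<Rightarrow> bool" where
  "d_cycle M Pr X \<psi> d D \<longleftrightarrow>
     d \<ge> 1 \<and> (\<forall>i<d. D i \<in> sets M) \<and> disjoint_family_on D {..<d} \<and>
     (\<forall>i<d. \<forall>x\<in>D i. measure (nstep_kernel M Pr X 1 x) (D (Suc i mod d)) = 1) \<and>
     space M - (\<Union>i<d. D i) \<in> null_sets \<psi>"

definition aperiodic ::
  "'a measure \<Rightarrow> ('a \<Rightarrow> 'w measure) \<Rightarrow> (nat \<Rightarrow> 'w \<Rightarrow> 'a) \<Rightarrow> 'a measure \<Rightarrow> bool" where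
  "aperiodic M Pr X \<psi> \<longleftrightarrow> (\<forall>d D. d_cycle M Pr X \<psi> d D \<longrightarrow> d \<le> 1)"

definition petite ::
  "'a measure \<Rightarrow> ('a \<Rightarrow> 'w measure) \<Rightarrow> (nat \<Rightarrow> 'w \<Rightarrow> 'a) \<Rightarrow> 'a set \<Rightarrow> bool" where
  "petite M Pr X C \<longleftrightarrow>
     C \<in> sets M \<and>
     (\<exists>(a :: nat pmf) \<nu>. sets \<nu> = sets M \<and> emeasure \<nu> (space M) > 0 \<and>
        (\<forall>x\<in>C. \<forall>B\<in>sets M.
           (\<Sum>n. ennreal (pmf a n) * emeasure (nstep_kernel M Pr X n x) B) \<ge> emeasure \<nu> B))"

definition harris_recurrent ::
  "'a measure \<Rightarrow> ('a \<Rightarrow> 'w measure) \<Rightarrow> (nat \<Rightarrow> 'w \<Rightarrow> 'a) \<Rightarrow> 'a measure \<Rightarrow> bool" where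
  "harris_recurrent M Pr X \<psi> \<longleftrightarrow>
     (\<forall>x\<in>space M. \<forall>A\<in>Bplus M \<psi>.
        \<P>(\<omega> in Pr x. (\<Sum>n. indicator A (X (Suc n) \<omega>) :: ennreal) = \<infinity>) = 1)"

definition return_time :: "(nat \<Rightarrow> 'w \<Rightarrow> 'a) \<Rightarrow> 'a set \<Rightarrow> 'w \<Rightarrow> enat" where
  "return_time X A \<omega> = Inf {enat n | n. n \<ge> 1 \<and> X n \<omega> \<in> A}"

text \<open>Only used for \<open>r > 1\<close>, hence the value at \<open>\<infinity>\<close>.\<close>

definition epow :: "real \<Rightarrow> enat \<Rightarrow> ennreal" where
  "epow r t = (case t of enat n \<Rightarrow> ennreal (r ^ n) | \<infinity> \<Rightarrow> \<infinity>)"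

definition geometrically_ergodic ::
  "'a measure \<Rightarrow> ('a \<Rightarrow> 'w measure) \<Rightarrow> (nat \<Rightarrow> 'w \<Rightarrow> 'a) \<Rightarrow> bool" where
  "geometrically_ergodic M Pr X \<longleftrightarrow>
     (\<exists>C r. C \<noteq> {} \<and> petite M Pr X C \<and> r > 1 \<and>
        (SUP x\<in>C. \<integral>\<^sup>+\<omega>. epow r (return_time X C \<omega>) \<partial>Pr x) < \<infinity>)"

end

theory Submission
  imports Defs
begin

text \<open>
  Let \<open>Q f(x) = \<integral>\<^bsub>A\<^sup>c\<^esub> f(y) P(x, dy)\<close>. If some \<open>U \<ge> 1\<close> and \<open>q < 1\<close> satisfy \<open>Q U \<le> q U\<close>, then iterating
  \<open>V\<^sup>(\<^sup>n\<^sup>) \<le> r\<^sub>n Q V\<^sup>(\<^sup>n\<^sup>) + 1\<close> for the bounded function \<open>V\<^sup>(\<^sup>n\<^sup>)\<close> gives \<open>V\<^sup>(\<^sup>n\<^sup>) \<le> U / (1 - r\<^sub>n q)\<close> once \<open>r\<^sub>n q < 1\<close>,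
  so \<open>sup\<^sub>n V\<^sup>(\<^sup>n\<^sup>)\<close> is finite wherever \<open>U\<close> is. It remains to extract \<open>U\<close> from geometric ergodicity, with
  \<open>U\<close> finite somewhere in every set of \<open>\<B>\<^sup>+\<close>.

  For the petite set \<open>C\<close>, the function \<open>w\<close> equal to \<open>1\<close> on \<open>C\<close> and to \<open>E\<^sub>x r\<^bsup>\<tau>\<^esup>\<close> (\<open>\<tau>\<close> the return time of \<open>C\<close>)
  off \<open>C\<close> satisfies \<open>P w \<le> w / r + L 1\<^sub>C\<close> with \<open>L = sup\<^sub>C E\<^sub>x r\<^bsup>\<tau>\<^esup>\<close>. Petiteness and irreducibility give \<open>N\<close> and \<open>\<delta> > 0\<close> such that
  from every point of \<open>C\<close> the set \<open>A\<close> is hit within \<open>N\<close> steps with probability at least \<open>\<delta>\<close>; hence the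
  bounded function \<open>g = \<Sum>\<^bsub>j<N\<^esub> Q\<^sup>j 1\<close> satisfies \<open>Q g \<le> g - \<delta> 1\<^sub>C\<close>, and \<open>U = w + (L / \<delta>) g\<close> is contracted.
  Finally \<open>P\<^sup>n w(x\<^sub>0) < \<infinity>\<close> for \<open>x\<^sub>0 \<in> C\<close> and all \<open>n\<close>, so by irreducibility \<open>w\<close>, and with it \<open>U\<close>, is finite
  somewhere in each set of \<open>\<B>\<^sup>+\<close>.
\<close>

section \<open>Auxiliary inequalities for integrals and real numbers\<close>

text \<open>\<open>ennreal\<close> discards the negative part, which can only enlarge the integral;
  without integrability the Bochner integral is 0 by convention. This carries the real-valued
  hypothesis on \<open>V n\<close> over to its positive part.\<close>

lemma ennreal_integral_le_nn_integral:
  fixes f :: "'a \<Rightarrow> real"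
  shows "ennreal (integral\<^sup>L M f) \<le> (\<integral>\<^sup>+x. ennreal (f x) \<partial>M)"
proof (cases "integrable M f")
  case True
  then have "integral\<^sup>L M f \<le> enn2real (\<integral>\<^sup>+x. ennreal (f x) \<partial>M)"
    by (simp add: real_lebesgue_integral_def)
  also have "ennreal \<dots> \<le> (\<integral>\<^sup>+x. ennreal (f x) \<partial>M)"
    by (cases "\<integral>\<^sup>+x. ennreal (f x) \<partial>M") auto
  finally show ?thesis by (simp add: ennreal_leI)
qed (simp add: not_integrable_integral_eq)

text \<open>The pointwise arithmetic of the contraction, with \<open>T\<close> for P w,
  \<open>h\<close> for Q g and \<open>n\<close> a bound on g. In both cases \<open>w + K * g\<close>
  drops by at least \<open>(1 - 1 / r) * w\<close>: off C by the decay of w, on C because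
  \<open>K * \<delta> = L\<close> pays for \<open>T\<close>. Since \<open>w\<close> is at least 1,
  it dominates \<open>(w + K * g) / (1 + K * n)\<close>, so the additive drop becomes a
  factor.\<close>

lemma drift_combination_real:
  fixes T w g h L \<delta> r n :: real
  defines "K \<equiv> L / \<delta>"
  assumes "0 < \<delta>" "1 < r" "0 \<le> L" "1 \<le> w" "0 \<le> T" "0 \<le> g" "g \<le> n" "h \<le> g"
    and "r * T = w \<or> r * T \<le> L \<and> w = 1 \<and> h + \<delta> \<le> g"
  shows "T + K * h \<le> (1 - (1 - 1 / r) / (1 + K * n)) * (w + K * g)"
proof -
  have "K \<ge> 0" using assms by (simp add: K_def)
  have "0 \<le> K * n" using assms \<open>K \<ge> 0\<close> by simp
  have "K * g \<le> K * n" using \<open>g \<le> n\<close> \<open>K \<ge> 0\<close> by (rule mult_left_mono)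
  have "w + K * g \<le> w * (1 + K * n)"
  proof -
    have "1 * (K * n) \<le> w * (K * n)"
      using \<open>1 \<le> w\<close> \<open>0 \<le> K * n\<close> by (rule mult_right_mono)
    with \<open>K * g \<le> K * n\<close> show ?thesis by (simp add: distrib_left)
  qed
  then have "(w + K * g) / (1 + K * n) \<le> w"
    using \<open>0 \<le> K * n\<close> by (simp add: divide_le_eq)
  then have "(1 - 1 / r) * ((w + K * g) / (1 + K * n)) \<le> (1 - 1 / r) * w"
    using assms by (intro mult_left_mono) auto
  moreover have "T + K * h \<le> w + K * g - (1 - 1 / r) * w"
    using assms(10)
  proof
    assume "r * T = w"
    then have "T = w / r" using assms by (auto simp: field_simps)
    moreover have "K * h \<le> K * g" using assms \<open>K \<ge> 0\<close> by (intro mult_left_mono) auto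
    ultimately show ?thesis by (simp add: algebra_simps)
  next
    assume *: "r * T \<le> L \<and> w = 1 \<and> h + \<delta> \<le> g"
    have "1 * T \<le> r * T" using assms by (intro mult_right_mono) auto
    moreover have "K * (h + \<delta>) \<le> K * g" using * \<open>K \<ge> 0\<close> by (intro mult_left_mono) auto
    moreover have "K * \<delta> = L" using assms by (simp add: K_def)
    ultimately have "T + K * h \<le> K * g" using * by (simp add: distrib_left)
    moreover have "w + K * g - (1 - 1 / r) * w = K * g + 1 / r" using * by simp
    moreover have "0 \<le> 1 / r" using assms by simp
    ultimately show ?thesis by linarith
  qed
  moreover have "(1 - (1 - 1 / r) / (1 + K * n)) * (w + K * g) =
    w + K * g - (1 - 1 / r) * ((w + K * g) / (1 + K * n))"
    by (simp add: algebra_simps)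
  ultimately show ?thesis by linarith
qed

subsection \<open>Kernels killed outside a set\<close>

text \<open>The operator Q of the introduction when \<open>D\<close> is the complement of A, and P
  itself when \<open>D\<close> is the whole space. The starting point is not tested against
  \<open>D\<close>, so the k-th iterate constrains times 1 to k only.\<close>

definition taboo :: "('a \<Rightarrow> 'a measure) \<Rightarrow> 'a set \<Rightarrow> ('a \<Rightarrow> ennreal) \<Rightarrow> 'a \<Rightarrow> ennreal" where
  "taboo P D f x = (\<integral>\<^sup>+y. indicator D y * f y \<partial>P x)"

locale markov_kernel =
  fixes M :: "'a measure" and P :: "'a \<Rightarrow> 'a measure"
  assumes kernel [measurable]: "P \<in> measurable M (prob_algebra M)"
begin

lemma
  assumes "x \<in> space M"
  shows prob_space_kernel: "prob_space (P x)" and sets_kernel: "sets (P x) = sets M"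
  using measurable_space[OF kernel assms] by (auto simp: space_prob_algebra)

lemma space_kernel: "x \<in> space M \<Longrightarrow> space (P x) = space M"
  by (rule sets_eq_imp_space_eq[OF sets_kernel])

lemma borel_measurable_kernel:
  "x \<in> space M \<Longrightarrow> f \<in> borel_measurable M \<Longrightarrow> f \<in> borel_measurable (P x)"
  by (simp add: measurable_cong_sets[OF sets_kernel refl])

lemma taboo_measurable [measurable]:
  assumes [measurable]: "D \<in> sets M" "f \<in> borel_measurable M"
  shows "taboo P D f \<in> borel_measurable M"
proof -
  have [measurable]: "P \<in> measurable M (subprob_algebra M)"
    by (rule measurable_prob_algebraD[OF kernel])
  show ?thesis
    unfolding taboo_def[abs_def]
    by (rule measurable_compose[OF \<open>P \<in> measurable M (subprob_algebra M)\<close>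
          nn_integral_measurable_subprob_algebra]) measurable
qed

lemma taboo_iter_measurable [measurable]:
  "D \<in> sets M \<Longrightarrow> f \<in> borel_measurable M \<Longrightarrow> (taboo P D ^^ k) f \<in> borel_measurable M"
  by (induction k) auto

lemma taboo_mono:
  assumes "x \<in> space M" "D \<subseteq> E" "\<And>y. y \<in> space M \<Longrightarrow> y \<in> D \<Longrightarrow> f y \<le> g y"
  shows "taboo P D f x \<le> taboo P E g x"
  unfolding taboo_def using assms
  by (intro nn_integral_mono) (auto simp: space_kernel split: split_indicator)

lemma taboo_add:
  assumes "x \<in> space M" "D \<in> sets M" "f \<in> borel_measurable M" "g \<in> borel_measurable M"
  shows "taboo P D (\<lambda>y. f y + g y) x = taboo P D f x + taboo P D g x"
  using assms unfolding taboo_def distrib_left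
  by (intro nn_integral_add borel_measurable_kernel) auto

lemma taboo_cmult:
  assumes "x \<in> space M" "D \<in> sets M" "f \<in> borel_measurable M"
  shows "taboo P D (\<lambda>y. c * f y) x = c * taboo P D f x"
  using assms unfolding taboo_def mult.left_commute[of _ c]
  by (intro nn_integral_cmult borel_measurable_kernel) auto

lemma taboo_suminf:
  assumes "x \<in> space M" "D \<in> sets M" "\<And>k::nat. f k \<in> borel_measurable M"
  shows "taboo P D (\<lambda>y. \<Sum>k. f k y) x = (\<Sum>k. taboo P D (f k) x)"
  using assms unfolding taboo_def ennreal_suminf_cmult[symmetric]
  by (intro nn_integral_suminf borel_measurable_kernel) auto

lemma taboo_sum:
  assumes "x \<in> space M" "D \<in> sets M" "\<And>k. f k \<in> borel_measurable M"
  shows "taboo P D (\<lambda>y. \<Sum>k<n::nat. f k y) x = (\<Sum>k<n. taboo P D (f k) x)"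
  using assms unfolding taboo_def sum_distrib_left
  by (intro nn_integral_sum borel_measurable_kernel) auto

lemma taboo_const_le:
  assumes "x \<in> space M"
  shows "taboo P D (\<lambda>_. c) x \<le> c"
proof -
  interpret prob_space "P x" by (rule prob_space_kernel[OF assms])
  have "taboo P D (\<lambda>_. c) x \<le> (\<integral>\<^sup>+y. c \<partial>P x)"
    unfolding taboo_def by (intro nn_integral_mono) (auto split: split_indicator)
  then show ?thesis by (simp add: emeasure_space_1)
qed

lemma taboo_one_space:
  assumes "x \<in> space M"
  shows "taboo P (space M) (\<lambda>_. 1) x = 1"
proof -
  interpret prob_space "P x" by (rule prob_space_kernel[OF assms])
  show ?thesis
    using emeasure_space_1 by (simp add: taboo_def space_kernel[OF assms, symmetric])
qed

lemma taboo_iter_le_one: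
  assumes "x \<in> space M"
  shows "(taboo P D ^^ k) (\<lambda>_. 1) x \<le> 1"
  using assms
proof (induction k arbitrary: x)
  case (Suc k)
  have "taboo P D ((taboo P D ^^ k) (\<lambda>_. 1)) x \<le> taboo P D (\<lambda>_. 1) x"
    using Suc by (intro taboo_mono) auto
  also have "\<dots> \<le> 1" using Suc by (intro taboo_const_le)
  finally show ?case by simp
qed simp

text \<open>
  In the probabilistic setting this is \<open>E\<^sub>x \<Sum>\<^bsub>k<\<tau>\<^esub> r\<^sup>k\<close> with \<open>\<tau>\<close> the first time \<open>\<ge> 1\<close> outside \<open>D\<close>.
\<close>

definition resolvent :: "real \<Rightarrow> 'a set \<Rightarrow> 'a \<Rightarrow> ennreal" where
  "resolvent r D x = (\<Sum>k. ennreal (r ^ k) * (taboo P D ^^ k) (\<lambda>_. 1) x)"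

lemma resolvent_measurable [measurable]:
  assumes [measurable]: "D \<in> sets M"
  shows "resolvent r D \<in> borel_measurable M"
  unfolding resolvent_def[abs_def] by measurable

text \<open>First-step decomposition: the term for k = 0 is 1, and every later term releases one
  factor \<open>r\<close> and one application of \<open>taboo\<close>.\<close>

lemma resolvent_unfold:
  assumes "x \<in> space M" "D \<in> sets M" "r \<ge> 0"
  shows "resolvent r D x = 1 + ennreal r * taboo P D (resolvent r D) x"
proof -
  have "resolvent r D x = 1 + (\<Sum>k. ennreal (r ^ Suc k) * (taboo P D ^^ Suc k) (\<lambda>_. 1) x)"
    unfolding resolvent_def
    by (subst suminf_offset[where i = 1]) (auto simp: ac_simps)
  also have "(\<Sum>k. ennreal (r ^ Suc k) * (taboo P D ^^ Suc k) (\<lambda>_. 1) x) =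
      (\<Sum>k. ennreal r * taboo P D (\<lambda>y. ennreal (r ^ k) * (taboo P D ^^ k) (\<lambda>_. 1) y) x)"
    using assms by (subst taboo_cmult) (auto simp: ennreal_mult mult.assoc)
  also have "\<dots> = ennreal r * taboo P D (resolvent r D) x"
    using assms unfolding resolvent_def[abs_def]
    by (subst taboo_suminf) (auto simp: ennreal_suminf_cmult)
  finally show ?thesis .
qed

section \<open>Lyapunov function, drift and contraction\<close>

text \<open>The function w of the introduction: by Abel summation
  \<open>1 + (r - 1) * resolvent\<close> is the expectation of r to the return time. Going through
  \<open>resolvent\<close> keeps it a matter of the kernel alone.\<close>

definition lyapunov :: "real \<Rightarrow> 'a set \<Rightarrow> 'a \<Rightarrow> ennreal" where
  "lyapunov r C x = 1 + ennreal (r - 1) * (indicator (space M - C) x * resolvent r (space M - C) x)"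

lemma lyapunov_measurable [measurable]:
  assumes [measurable]: "C \<in> sets M"
  shows "lyapunov r C \<in> borel_measurable M"
  unfolding lyapunov_def[abs_def] by measurable

text \<open>The indicator inside \<open>lyapunov\<close> turns integration over the whole space into
  \<open>taboo\<close> off C, and \<open>resolvent_unfold\<close> closes the loop. The right side is
  w itself off C, and is at most L on C once the return-time moments there are bounded.\<close>

lemma lyapunov_drift:
  assumes "x \<in> space M" "C \<in> sets M" "r > 1"
  shows "ennreal r * taboo P (space M) (lyapunov r C) x = 1 + ennreal (r - 1) * resolvent r (space M - C) x"
proof -
  let ?D = "space M - C" and ?R = "resolvent r (space M - C)"
  have *: "taboo P (space M) (\<lambda>y. indicator ?D y * ?R y) x = taboo P ?D ?R x"
    unfolding taboo_def using assms
    by (intro nn_integral_cong) (auto split: split_indicator simp: space_kernel)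
  have "taboo P (space M) (lyapunov r C) x = 1 + ennreal (r - 1) * taboo P ?D ?R x"
    unfolding lyapunov_def[abs_def] using assms
    by (subst taboo_add) (simp_all add: taboo_cmult taboo_one_space *)
  then have "ennreal r * taboo P (space M) (lyapunov r C) x = ennreal r + ennreal (r - 1) * (ennreal r * taboo P ?D ?R x)"
    by (simp add: distrib_left ac_simps)
  also have "\<dots> = 1 + ennreal (r - 1) + ennreal (r - 1) * (ennreal r * taboo P ?D ?R x)"
    using assms by (intro arg_cong2[where f = "(+)"]) (simp_all flip: ennreal_1 ennreal_plus)
  also have "\<dots> = 1 + ennreal (r - 1) * (1 + ennreal r * taboo P ?D ?R x)"
    by (simp add: distrib_left add.assoc)
  also have "1 + ennreal r * taboo P ?D ?R x = ?R x"
    using assms by (intro resolvent_unfold[symmetric]) auto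
  finally show ?thesis .
qed

lemma lyapunov_ge_one: "1 \<le> lyapunov r C x"
  by (simp add: lyapunov_def)

text \<open>Applying \<open>taboo\<close> shifts the sum by one index, so it telescopes. Additions
  on both sides avoid truncated subtraction in \<open>ennreal\<close>.\<close>

lemma taboo_sum_iter_add_one:
  assumes "x \<in> space M" "D \<in> sets M"
  shows "taboo P D (\<lambda>y. \<Sum>j<N. (taboo P D ^^ j) (\<lambda>_. 1) y) x + 1 =
    (\<Sum>j<N. (taboo P D ^^ j) (\<lambda>_. 1) x) + (taboo P D ^^ N) (\<lambda>_. 1) x"
proof -
  have "taboo P D (\<lambda>y. \<Sum>j<N. (taboo P D ^^ j) (\<lambda>_. 1) y) x + 1 =
    (\<Sum>j<Suc N. (taboo P D ^^ j) (\<lambda>_. 1) x)"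
    unfolding sum.lessThan_Suc_shift using assms by (subst taboo_sum) (auto simp: ac_simps)
  then show ?thesis by simp
qed

text \<open>Neither summand of \<open>U\<close> contracts by itself: w decays only off C, and g
  decreases on C by at least \<open>\<delta>\<close> because killing has probability at least
  \<open>\<delta>\<close> within \<open>N\<close> steps. The weight \<open>K\<close> balances the
  two.\<close>

lemma taboo_contraction_exists:
  assumes [measurable]: "C \<in> sets M" "D \<in> sets M"
    and r: "1 < r" and \<delta>: "0 < \<delta>" "\<delta> \<le> 1" and L: "0 \<le> L"
    and bound: "\<And>x. x \<in> C \<Longrightarrow> 1 + ennreal (r - 1) * resolvent r (space M - C) x \<le> ennreal L"
    and hit: "\<And>x. x \<in> C \<Longrightarrow> (taboo P D ^^ N) (\<lambda>_. 1) x \<le> ennreal (1 - \<delta>)"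
  obtains U q where "U \<in> borel_measurable M" "0 < q" "q < 1"
    "\<And>x. 1 \<le> U x" "\<And>x. x \<in> space M \<Longrightarrow> taboo P D U x \<le> ennreal q * U x"
    "\<And>x. x \<in> space M \<Longrightarrow> lyapunov r C x < \<top> \<Longrightarrow> U x < \<top>"
proof -
  define K where "K = L / \<delta>"
  define g where "g x = (\<Sum>j<N. (taboo P D ^^ j) (\<lambda>_. 1) x)" for x
  define U where "U x = lyapunov r C x + ennreal K * g x" for x
  define q where "q = 1 - (1 - 1 / r) / (1 + K * real N)"
  have "K \<ge> 0" using L \<delta> by (simp add: K_def)
  have [measurable]: "g \<in> borel_measurable M" unfolding g_def[abs_def] by measurable
  have [measurable]: "U \<in> borel_measurable M" unfolding U_def[abs_def] by measurable
  have g_le: "g x \<le> ennreal (real N)" if "x \<in> space M" for x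
  proof -
    have "g x \<le> (\<Sum>j<N. 1)" unfolding g_def using taboo_iter_le_one[OF that] by (intro sum_mono)
    then show ?thesis by (simp add: ennreal_of_nat_eq_real_of_nat)
  qed
  have taboo_g: "taboo P D g x + 1 = g x + (taboo P D ^^ N) (\<lambda>_. 1) x" if "x \<in> space M" for x
    unfolding g_def using that by (intro taboo_sum_iter_add_one) auto
  have q01: "0 < q" "q < 1"
  proof -
    have "0 \<le> K * real N" using \<open>K \<ge> 0\<close> by simp
    moreover have "0 < 1 - 1 / r" "1 - 1 / r < 1" using r by auto
    ultimately have "0 < (1 - 1 / r) / (1 + K * real N)" "1 - 1 / r < 1 + K * real N"
      by (simp, linarith)
    with \<open>0 \<le> K * real N\<close> have "(1 - 1 / r) / (1 + K * real N) < 1"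
      by (subst divide_less_eq_1_pos) auto
    note this \<open>0 < (1 - 1 / r) / (1 + K * real N)\<close>
    then show "0 < q" "q < 1" by (auto simp: q_def)
  qed
  have "taboo P D U x \<le> ennreal q * U x" if x: "x \<in> space M" for x
  proof (cases "lyapunov r C x = \<top>")
    case True
    \<comment> \<open>Positivity of \<open>q\<close> matters: in \<open>ennreal\<close> the product
      of 0 and \<open>\<top>\<close> is 0.\<close>
    then show ?thesis using q01 by (simp add: U_def ennreal_mult_top)
  next
    case False
    define R where "R = 1 + ennreal (r - 1) * resolvent r (space M - C) x"
    define T where "T = taboo P (space M) (lyapunov r C) x"
    have drift: "ennreal r * T = R"
      unfolding T_def R_def using x r by (intro lyapunov_drift) auto
    have R_cases: "R = lyapunov r C x \<or> (x \<in> C \<and> R \<le> ennreal L \<and> lyapunov r C x = 1)"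
      using bound[of x] x by (cases "x \<in> C") (simp_all add: R_def lyapunov_def)
    then have "R < \<top>" using False by (auto simp: top.not_eq_extremum intro: le_less_trans)
    then have "T < \<top>" using drift r by (auto simp: ennreal_mult_less_top)
    have h_le: "taboo P D g x \<le> g x"
    proof -
      have "taboo P D g x + 1 \<le> g x + 1"
        unfolding taboo_g[OF x] using taboo_iter_le_one[OF x] by (intro add_left_mono)
      then show ?thesis by (simp add: add.commute[of _ 1] ennreal_add_left_cancel_le)
    qed
    \<comment> \<open>Adding \<open>1 - \<delta>\<close> to both sides and cancelling it stands in
      for a subtraction.\<close>
    have h_le': "taboo P D g x + ennreal \<delta> \<le> g x" if "x \<in> C"
    proof -
      have "ennreal (1 - \<delta>) + (taboo P D g x + ennreal \<delta>) = taboo P D g x + 1"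
        using \<delta> by (simp add: ac_simps flip: ennreal_plus)
      also have "\<dots> \<le> ennreal (1 - \<delta>) + g x"
        unfolding taboo_g[OF x] using hit[OF that] by (simp add: add.commute add_left_mono)
      finally show ?thesis by (simp add: ennreal_add_left_cancel_le)
    qed
    \<comment> \<open>All four quantities at \<open>x\<close> are finite, so the claim reduces to
      real arithmetic.\<close>
    obtain w where w: "0 \<le> w" "lyapunov r C x = ennreal w"
      using False by (cases "lyapunov r C x") auto
    have "1 \<le> w" using lyapunov_ge_one[of r C x] w by simp
    obtain t where t: "0 \<le> t" "T = ennreal t"
      using \<open>T < \<top>\<close> by (cases T) auto
    obtain a where a: "0 \<le> a" "g x = ennreal a"
      using g_le[OF x] by (cases "g x") (auto simp: top_unique)
    obtain h where h: "0 \<le> h" "taboo P D g x = ennreal h"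
      using h_le a by (cases "taboo P D g x") (auto simp: top_unique)
    have "t + K * h \<le> q * (w + K * a)"
      unfolding K_def q_def
    proof (rule drift_combination_real)
      show "r * t = w \<or> r * t \<le> L \<and> w = 1 \<and> h + \<delta> \<le> a"
        using R_cases
      proof
        assume "R = lyapunov r C x"
        then have "ennreal (r * t) = ennreal w" using drift t w r by (simp add: ennreal_mult)
        then show ?thesis using t w r by simp
      next
        assume *: "x \<in> C \<and> R \<le> ennreal L \<and> lyapunov r C x = 1"
        then have "ennreal (r * t) \<le> ennreal L" using drift t r by (simp add: ennreal_mult)
        moreover have "ennreal (h + \<delta>) \<le> ennreal a"
          using h_le' * h a \<delta> by simp
        ultimately show ?thesis using * w L a by (auto simp flip: ennreal_1)
      qed
      show "a \<le> real N" using g_le[OF x] a by simp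
      show "h \<le> a" using h_le a h by simp
    qed (use r \<delta> L t a \<open>1 \<le> w\<close> in auto)
    have "taboo P D U x = taboo P D (lyapunov r C) x + ennreal K * taboo P D g x"
      unfolding U_def[abs_def] using x by (simp add: taboo_add taboo_cmult)
    \<comment> \<open>For w the killing is given up and the full kernel is used; only g profits from
      it.\<close>
    also have "\<dots> \<le> T + ennreal K * taboo P D g x"
      unfolding T_def using x sets.sets_into_space[of D M] by (intro add_right_mono taboo_mono) auto
    also have "\<dots> = ennreal (t + K * h)"
      using t h \<open>K \<ge> 0\<close> by (simp add: ennreal_mult)
    also have "\<dots> \<le> ennreal (q * (w + K * a))"
      using \<open>t + K * h \<le> q * (w + K * a)\<close> by (rule ennreal_leI)
    also have "\<dots> = ennreal q * U x"
      unfolding U_def w(2) a(2) using q01 w a \<open>K \<ge> 0\<close> by (simp add: ennreal_mult)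
    finally show ?thesis .
  qed
  moreover have "1 \<le> U x" for x
    unfolding U_def using lyapunov_ge_one[of r C x] by (rule order.trans) simp
  moreover have "U x < \<top>" if "x \<in> space M" "lyapunov r C x < \<top>" for x
    unfolding U_def using that g_le[of x]
    by (auto simp: ennreal_mult_less_top intro: le_less_trans)
  ultimately show ?thesis
    using that[of U q] q01 \<open>U \<in> borel_measurable M\<close> by blast
qed

text \<open>The crude drift P w \<le> w + L, iterated, adds at most L per step. Hence, wherever w is
  finite at the start, it is almost surely finite at each later time.\<close>

lemma lyapunov_iter_finite:
  assumes [measurable]: "C \<in> sets M"
    and r: "1 < r" and L: "0 \<le> L"
    and bound: "\<And>x. x \<in> C \<Longrightarrow> 1 + ennreal (r - 1) * resolvent r (space M - C) x \<le> ennreal L"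
    and x: "x \<in> space M"
  shows "(taboo P (space M) ^^ n) (lyapunov r C) x \<le> lyapunov r C x + ennreal (real n * L)"
  using x
proof (induction n arbitrary: x)
  case (Suc n)
  have "(taboo P (space M) ^^ Suc n) (lyapunov r C) x
      \<le> taboo P (space M) (\<lambda>y. lyapunov r C y + ennreal (real n * L)) x"
    using Suc by (auto intro!: taboo_mono)
  also have "\<dots> \<le> taboo P (space M) (lyapunov r C) x + ennreal (real n * L)"
    using Suc taboo_const_le[of x "space M"] by (subst taboo_add) (auto intro!: add_left_mono)
  also have "taboo P (space M) (lyapunov r C) x \<le> lyapunov r C x + ennreal L"
  proof -
    have "taboo P (space M) (lyapunov r C) x \<le> ennreal r * taboo P (space M) (lyapunov r C) x"
      using r mult_right_mono[of 1 "ennreal r" "taboo P (space M) (lyapunov r C) x"] by simp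
    also have "\<dots> = 1 + ennreal (r - 1) * resolvent r (space M - C) x"
      using Suc.prems r by (intro lyapunov_drift) auto
    also have "\<dots> \<le> lyapunov r C x + ennreal L"
      using bound[of x] Suc.prems by (cases "x \<in> C") (auto simp: lyapunov_def add_increasing)
    finally show ?thesis .
  qed
  also have "lyapunov r C x + ennreal L + ennreal (real n * L) = lyapunov r C x + ennreal (real (Suc n) * L)"
    using L by (simp add: add.assoc distrib_right flip: ennreal_plus)
  finally show ?case by (simp add: add_right_mono)
qed simp

section \<open>Comparison of bounded subsolutions with a contracted function\<close>

text \<open>Starting from v \<le> b \<le> b U, each use of the inequality for \<open>v\<close>
  multiplies the excess over c U by r q, where c solves c = 1 + r q c. The excess vanishes in the
  limit, so the bound is independent of \<open>b\<close>.\<close>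

lemma subsolution_le:
  assumes [measurable]: "D \<in> sets M" "U \<in> borel_measurable M"
    and U: "\<And>x. 1 \<le> U x" "\<And>x. x \<in> space M \<Longrightarrow> taboo P D U x \<le> ennreal q * U x"
    and q: "0 \<le> q" and r: "0 \<le> r" "r * q < 1" and b: "0 \<le> b"
    and v_le: "\<And>x. x \<in> space M \<Longrightarrow> v x \<le> ennreal b"
    and v: "\<And>x. x \<in> space M \<Longrightarrow> v x \<le> ennreal r * taboo P D v x + 1"
    and x: "x \<in> space M"
  shows "v x \<le> ennreal (1 / (1 - r * q)) * U x"
proof -
  define c where "c = 1 / (1 - r * q)"
  have c: "0 \<le> c" "1 + r * q * c = c"
    using r by (auto simp: c_def field_simps)
  have rq: "0 \<le> r * q" using r q by simp
  have iter: "v x \<le> ennreal (c + b * (r * q) ^ m) * U x" if "x \<in> space M" for m x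
    using that
  proof (induction m arbitrary: x)
    case 0
    have "v x \<le> ennreal b * 1" using v_le 0 by simp
    also have "\<dots> \<le> ennreal (c + b) * U x"
      using U c b by (intro mult_mono ennreal_leI) auto
    finally show ?case by simp
  next
    case (Suc m)
    let ?d = "c + b * (r * q) ^ m"
    have "0 \<le> ?d" using b c rq by simp
    have "v x \<le> ennreal r * taboo P D v x + 1" by (rule v[OF Suc.prems])
    also have "taboo P D v x \<le> taboo P D (\<lambda>y. ennreal ?d * U y) x"
      using Suc by (intro taboo_mono) auto
    also have "\<dots> = ennreal ?d * taboo P D U x"
      using Suc.prems by (intro taboo_cmult) auto
    also have "\<dots> \<le> ennreal ?d * (ennreal q * U x)"
      using U Suc.prems by (intro mult_left_mono) auto
    \<comment> \<open>The inhomogeneous term 1 is absorbed by \<open>U x\<close>, which is at least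
      1.\<close>
    also have "ennreal r * (ennreal ?d * (ennreal q * U x)) + 1 \<le>
        ennreal (r * q * ?d) * U x + 1 * U x"
      using U(1)[of x] q r \<open>0 \<le> ?d\<close> by (simp add: ennreal_mult ac_simps add_mono)
    also have "\<dots> = ennreal (r * q * ?d + 1) * U x"
      using rq \<open>0 \<le> ?d\<close> by (simp add: distrib_right)
    also have "r * q * ?d + 1 = c + b * (r * q) ^ Suc m"
      using c by (simp add: algebra_simps)
    finally show ?case by (simp add: mult_left_mono add_mono mult_right_mono)
  qed
  have "(\<lambda>m. c + b * (r * q) ^ m) \<longlonglongrightarrow> c + b * 0"
    using r rq by (intro tendsto_intros LIMSEQ_power_zero) auto
  then have "(\<lambda>m. ennreal (c + b * (r * q) ^ m)) \<longlonglongrightarrow> ennreal c"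
    by (auto intro: tendsto_ennrealI)
  show ?thesis
  proof (cases "U x = \<top>")
    case True
    have "0 < 1 / (1 - r * q)" using r by simp
    then show ?thesis using True by (simp add: ennreal_mult_top)
  next
    case False
    have "(\<lambda>m. U x * ennreal (c + b * (r * q) ^ m)) \<longlonglongrightarrow> U x * ennreal c"
      using False by (intro ennreal_tendsto_cmult \<open>(\<lambda>m. ennreal (c + b * (r * q) ^ m)) \<longlonglongrightarrow> ennreal c\<close>)
        (auto simp: top.not_eq_extremum)
    then have "(\<lambda>m. ennreal (c + b * (r * q) ^ m) * U x) \<longlonglongrightarrow> ennreal c * U x"
      by (simp add: mult.commute)
    then show ?thesis
      using iter[OF x] unfolding c_def by (intro LIMSEQ_le_const) auto
  qed
qed

end

subsection \<open>Path integrals of the chain\<close>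

locale markov_process =
  fixes M :: "'a measure" and \<Omega> :: "'w measure" and Pr :: "'a \<Rightarrow> 'w measure"
    and X :: "nat \<Rightarrow> 'w \<Rightarrow> 'a" and P :: "'a \<Rightarrow> 'a measure"
  assumes chain: "markov_chain M \<Omega> Pr X" and P_eq: "P = nstep_kernel M Pr X 1"
begin

lemma X_measurable [measurable]: "X n \<in> measurable \<Omega> M"
  using chain by (simp add: markov_chain_def)

lemma
  assumes "x \<in> space M"
  shows prob_space_law: "prob_space (Pr x)" and sets_law: "sets (Pr x) = sets \<Omega>"
    and distr_initial: "distr (Pr x) M (X 0) = return M x"
  using chain assms by (simp_all add: markov_chain_def)

lemma space_law: "x \<in> space M \<Longrightarrow> space (Pr x) = space \<Omega>"
  by (rule sets_eq_imp_space_eq[OF sets_law])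

lemma measurable_law: "x \<in> space M \<Longrightarrow> measurable (Pr x) N = measurable \<Omega> N"
  by (rule measurable_cong_sets[OF sets_law refl])

sublocale markov_kernel M P
  using chain P_eq by (simp add: markov_chain_def markov_kernel_def)

lemma history_map_measurable: "(\<lambda>\<omega>. \<lambda>i\<in>{..n}. X i \<omega>) \<in> measurable \<Omega> (PiM {..n} (\<lambda>_. M))"
  by (intro measurable_restrict) simp

lemma subalgebra_history:
  assumes "x \<in> space M"
  shows "subalgebra (Pr x) (history M \<Omega> X n)"
  unfolding subalgebra_def
proof
  show "space (history M \<Omega> X n) = space (Pr x)"
    by (simp add: history_def space_law[OF assms])
  show "sets (history M \<Omega> X n) \<subseteq> sets (Pr x)"
    unfolding history_def sets_law[OF assms]
    by (rule sets_image_in_sets[OF refl history_map_measurable])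
qed

lemma X_measurable_history:
  assumes "i \<le> n"
  shows "X i \<in> measurable (history M \<Omega> X n) M"
proof -
  have "(\<lambda>\<omega>. \<lambda>i\<in>{..n}. X i \<omega>) \<in> measurable (history M \<Omega> X n) (PiM {..n} (\<lambda>_. M))"
    unfolding history_def using measurable_space[OF history_map_measurable]
    by (intro measurable_vimage_algebra1) auto
  from measurable_compose[OF this measurable_component_singleton[of i]]
  show ?thesis using assms by simp
qed

text \<open>The defining conditional expectation is integrated over the history event
  \<open>H\<close>. Both integrands are bounded by 1, hence integrable, which allows the passage
  from Bochner to nonnegative integrals.\<close>

lemma markov_property_indicator:
  assumes x: "x \<in> space M" and H: "H \<in> sets (history M \<Omega> X n)" and B [measurable]: "B \<in> sets M"
  shows "(\<integral>\<^sup>+\<omega>. indicator H \<omega> * indicator B (X (Suc n) \<omega>) \<partial>Pr x) =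
    (\<integral>\<^sup>+\<omega>. indicator H \<omega> * emeasure (P (X n \<omega>)) B \<partial>Pr x)"
proof -
  interpret prob_space "Pr x" by (rule prob_space_law[OF x])
  interpret finite_measure_subalgebra "Pr x" "history M \<Omega> X n"
    by unfold_locales (rule subalgebra_history[OF x])
  note [measurable_cong] = sets_law[OF x]
  have HS [measurable]: "H \<in> sets \<Omega>"
    using subalgebra_history[OF x, of n] H by (auto simp: subalgebra_def sets_law[OF x])
  have [measurable]: "P \<in> measurable M (subprob_algebra M)"
    by (rule measurable_prob_algebraD[OF kernel])
  let ?p = "\<lambda>\<omega>. measure (P (X n \<omega>)) B"
  have p_meas [measurable]: "?p \<in> borel_measurable \<Omega>"
    by (rule measurable_compose[OF X_measurable]) (measurable)
  have Xsp: "X n \<omega> \<in> space M" if "\<omega> \<in> space (Pr x)" for \<omega>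
    using that measurable_space[OF X_measurable] by (simp add: space_law[OF x])
  have p_le: "?p \<omega> \<le> 1" if "\<omega> \<in> space (Pr x)" for \<omega>
    using prob_space.prob_le_1[OF prob_space_kernel[OF Xsp[OF that]]] .
  have int_f: "integrable (Pr x) (\<lambda>\<omega>. indicator B (X (Suc n) \<omega>) :: real)"
    by (rule integrable_const_bound[where B = 1]) auto
  have int1: "integrable (Pr x) (\<lambda>\<omega>. indicator H \<omega> * indicator B (X (Suc n) \<omega>) :: real)"
    by (rule integrable_const_bound[where B = 1]) (auto split: split_indicator)
  have int2: "integrable (Pr x) (\<lambda>\<omega>. indicator H \<omega> * ?p \<omega>)"
    by (rule integrable_const_bound[where B = 1]) (auto split: split_indicator simp: p_le)
  have "(\<integral>\<omega>. indicator H \<omega> * indicator B (X (Suc n) \<omega>) \<partial>Pr x) =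
      (\<integral>\<omega>. indicator H \<omega> * real_cond_exp (Pr x) (history M \<Omega> X n) (\<lambda>\<omega>'. indicator B (X (Suc n) \<omega>')) \<omega> \<partial>Pr x)"
    using real_cond_exp_intA[OF int_f H] by (simp add: set_lebesgue_integral_def)
  also have "\<dots> = (\<integral>\<omega>. indicator H \<omega> * ?p \<omega> \<partial>Pr x)"
  proof (rule integral_cong_AE)
    have "AE \<omega> in Pr x. real_cond_exp (Pr x) (history M \<Omega> X n) (\<lambda>\<omega>'. indicator B (X (Suc n) \<omega>')) \<omega> = ?p \<omega>"
      using chain x B by (simp add: markov_chain_def P_eq)
    then show "AE \<omega> in Pr x. indicator H \<omega> * real_cond_exp (Pr x) (history M \<Omega> X n) (\<lambda>\<omega>'. indicator B (X (Suc n) \<omega>')) \<omega>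
       = indicator H \<omega> * ?p \<omega>"
      by eventually_elim simp
  qed measurable
  finally have eq: "(\<integral>\<omega>. indicator H \<omega> * indicator B (X (Suc n) \<omega>) \<partial>Pr x) = (\<integral>\<omega>. indicator H \<omega> * ?p \<omega> \<partial>Pr x)" .
  have "(\<integral>\<^sup>+\<omega>. indicator H \<omega> * indicator B (X (Suc n) \<omega>) \<partial>Pr x) =
      (\<integral>\<^sup>+\<omega>. ennreal (indicator H \<omega> * indicator B (X (Suc n) \<omega>)) \<partial>Pr x)"
    by (intro nn_integral_cong) (auto split: split_indicator)
  also have "\<dots> = ennreal (\<integral>\<omega>. indicator H \<omega> * indicator B (X (Suc n) \<omega>) \<partial>Pr x)"
    by (intro nn_integral_eq_integral int1) auto
  also have "\<dots> = (\<integral>\<^sup>+\<omega>. ennreal (indicator H \<omega> * ?p \<omega>) \<partial>Pr x)"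
    unfolding eq by (intro nn_integral_eq_integral[symmetric] int2) auto
  also have "\<dots> = (\<integral>\<^sup>+\<omega>. indicator H \<omega> * emeasure (P (X n \<omega>)) B \<partial>Pr x)"
  proof (rule nn_integral_cong)
    fix \<omega> assume "\<omega> \<in> space (Pr x)"
    then interpret K: prob_space "P (X n \<omega>)"
      by (intro prob_space_kernel Xsp)
    show "ennreal (indicator H \<omega> * ?p \<omega>) = indicator H \<omega> * emeasure (P (X n \<omega>)) B"
      by (auto simp: K.emeasure_eq_measure split: split_indicator)
  qed
  finally show ?thesis .
qed

text \<open>Both sides are additive, homogeneous and continuous along increasing sequences in
  \<open>f\<close>, so the case of indicators extends to all nonnegative measurable
  functions.\<close>

lemma markov_property:
  assumes x: "x \<in> space M" and H: "H \<in> sets (history M \<Omega> X n)" and f: "f \<in> borel_measurable M"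
  shows "(\<integral>\<^sup>+\<omega>. indicator H \<omega> * f (X (Suc n) \<omega>) \<partial>Pr x) =
    (\<integral>\<^sup>+\<omega>. indicator H \<omega> * (\<integral>\<^sup>+y. f y \<partial>P (X n \<omega>)) \<partial>Pr x)"
proof -
  note [measurable_cong] = sets_law[OF x]
  have HS [measurable]: "H \<in> sets \<Omega>"
    using subalgebra_history[OF x, of n] H by (auto simp: subalgebra_def sets_law[OF x])
  have K: "P \<in> measurable M (subprob_algebra M)"
    by (rule measurable_prob_algebraD[OF kernel])
  have Kint [measurable]: "(\<lambda>\<omega>. \<integral>\<^sup>+y. g y \<partial>P (X n \<omega>)) \<in> borel_measurable \<Omega>"
    if "g \<in> borel_measurable M" for g :: "'a \<Rightarrow> ennreal"
    using that by (intro measurable_compose[OF X_measurable]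
        measurable_compose[OF K nn_integral_measurable_subprob_algebra])
  have Xsp: "X m \<omega> \<in> space M" if "\<omega> \<in> space (Pr x)" for m \<omega>
    using that measurable_space[OF X_measurable] by (simp add: space_law[OF x])
  have gK: "g \<in> borel_measurable (P (X m \<omega>))"
    if "g \<in> borel_measurable M" "\<omega> \<in> space (Pr x)" for g :: "'a \<Rightarrow> ennreal" and m \<omega>
    using that by (intro borel_measurable_kernel Xsp)
  show ?thesis
    using f
  proof (induction f rule: borel_measurable_induct)
    case (cong f g)
    have "(\<integral>\<^sup>+\<omega>. indicator H \<omega> * f (X (Suc n) \<omega>) \<partial>Pr x) = (\<integral>\<^sup>+\<omega>. indicator H \<omega> * g (X (Suc n) \<omega>) \<partial>Pr x)"
      using cong.hyps(3) Xsp by (intro nn_integral_cong) auto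
    moreover have "(\<integral>\<^sup>+y. f y \<partial>P (X n \<omega>)) = (\<integral>\<^sup>+y. g y \<partial>P (X n \<omega>))"
      if "\<omega> \<in> space (Pr x)" for \<omega>
      using cong.hyps(3) space_kernel[OF Xsp[OF that]] by (intro nn_integral_cong) auto
    then have "(\<integral>\<^sup>+\<omega>. indicator H \<omega> * (\<integral>\<^sup>+y. f y \<partial>P (X n \<omega>)) \<partial>Pr x) =
        (\<integral>\<^sup>+\<omega>. indicator H \<omega> * (\<integral>\<^sup>+y. g y \<partial>P (X n \<omega>)) \<partial>Pr x)"
      by (intro nn_integral_cong) auto
    ultimately show ?case using cong.IH by simp
  next
    case (set B)
    then have "(\<integral>\<^sup>+y. indicator B y \<partial>P (X n \<omega>)) = emeasure (P (X n \<omega>)) B"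
      if "\<omega> \<in> space (Pr x)" for \<omega>
      using sets_kernel[OF Xsp[OF that]] by (intro nn_integral_indicator) auto
    then have "(\<integral>\<^sup>+\<omega>. indicator H \<omega> * (\<integral>\<^sup>+y. indicator B y \<partial>P (X n \<omega>)) \<partial>Pr x) =
        (\<integral>\<^sup>+\<omega>. indicator H \<omega> * emeasure (P (X n \<omega>)) B \<partial>Pr x)"
      by (intro nn_integral_cong) auto
    then show ?case using markov_property_indicator[OF x H set] by simp
  next
    case (mult u c)
    note [measurable] = mult.hyps(2)
    have "(\<integral>\<^sup>+\<omega>. indicator H \<omega> * (c * u (X (Suc n) \<omega>)) \<partial>Pr x) = c * (\<integral>\<^sup>+\<omega>. indicator H \<omega> * u (X (Suc n) \<omega>) \<partial>Pr x)"
      by (subst nn_integral_cmult[symmetric]) (auto simp: ac_simps)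
    also have "\<dots> = (\<integral>\<^sup>+\<omega>. indicator H \<omega> * (c * (\<integral>\<^sup>+y. u y \<partial>P (X n \<omega>))) \<partial>Pr x)"
      unfolding mult.IH by (subst nn_integral_cmult[symmetric]) (auto simp: ac_simps)
    also have "\<dots> = (\<integral>\<^sup>+\<omega>. indicator H \<omega> * (\<integral>\<^sup>+y. c * u y \<partial>P (X n \<omega>)) \<partial>Pr x)"
      by (intro nn_integral_cong) (simp add: nn_integral_cmult gK)
    finally show ?case .
  next
    case (add u v)
    note [measurable] = add.hyps(1,3)
    have "(\<integral>\<^sup>+\<omega>. indicator H \<omega> * (v (X (Suc n) \<omega>) + u (X (Suc n) \<omega>)) \<partial>Pr x) =
      (\<integral>\<^sup>+\<omega>. indicator H \<omega> * v (X (Suc n) \<omega>) \<partial>Pr x) + (\<integral>\<^sup>+\<omega>. indicator H \<omega> * u (X (Suc n) \<omega>) \<partial>Pr x)"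
      unfolding distrib_left by (intro nn_integral_add) auto
    also have "\<dots> = (\<integral>\<^sup>+\<omega>. indicator H \<omega> * ((\<integral>\<^sup>+y. v y \<partial>P (X n \<omega>)) +
        (\<integral>\<^sup>+y. u y \<partial>P (X n \<omega>))) \<partial>Pr x)"
      unfolding add.IH distrib_left by (intro nn_integral_add[symmetric]) auto
    also have "\<dots> = (\<integral>\<^sup>+\<omega>. indicator H \<omega> * (\<integral>\<^sup>+y. v y + u y \<partial>P (X n \<omega>)) \<partial>Pr x)"
      by (intro nn_integral_cong) (simp add: nn_integral_add gK)
    finally show ?case .
  next
    case (seq U)
    note [measurable] = seq.hyps(1)
    have incs: "incseq (\<lambda>i \<omega>. indicator H \<omega> * U i (X (Suc n) \<omega>))"
      using seq.hyps(3) by (auto simp: incseq_def le_fun_def intro: mult_left_mono)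
    have incI: "incseq (\<lambda>i \<omega>. indicator H \<omega> * (\<integral>\<^sup>+y. U i y \<partial>P (X n \<omega>)))"
      using seq.hyps(3) by (auto simp: incseq_def le_fun_def intro!: mult_left_mono nn_integral_mono)
    have "(\<integral>\<^sup>+\<omega>. indicator H \<omega> * (SUP i. U i (X (Suc n) \<omega>)) \<partial>Pr x) =
       (SUP i. \<integral>\<^sup>+\<omega>. indicator H \<omega> * U i (X (Suc n) \<omega>) \<partial>Pr x)"
      unfolding SUP_mult_left_ennreal using incs by (intro nn_integral_monotone_convergence_SUP) auto
    also have "\<dots> = (\<integral>\<^sup>+\<omega>. indicator H \<omega> * (SUP i. (\<integral>\<^sup>+y. U i y \<partial>P (X n \<omega>))) \<partial>Pr x)"
      unfolding seq.IH SUP_mult_left_ennreal using incI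
      by (intro nn_integral_monotone_convergence_SUP[symmetric]) auto
    also have "\<dots> = (\<integral>\<^sup>+\<omega>. indicator H \<omega> * (\<integral>\<^sup>+y. (SUP i. U i y) \<partial>P (X n \<omega>)) \<partial>Pr x)"
      using seq.hyps(3) by (intro nn_integral_cong) (simp add: nn_integral_monotone_convergence_SUP gK seq.hyps(1))
    finally show ?case by (simp add: image_comp)
  qed
qed

text \<open>Links the operators to the paths. The event on times 1 to k belongs to the history at
  time k, so the induction only conditions on the past under the one law \<open>Pr x\<close>; no
  shift of paths is involved.\<close>

lemma taboo_iter_eq_path_integral:
  assumes x: "x \<in> space M" and D [measurable]: "D \<in> sets M" and f: "f \<in> borel_measurable M"
  shows "(taboo P D ^^ k) f x =
    (\<integral>\<^sup>+\<omega>. indicator {\<omega> \<in> space \<Omega>. \<forall>i\<in>{1..k}. X i \<omega> \<in> D} \<omega> * f (X k \<omega>) \<partial>Pr x)"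
  using f
proof (induction k arbitrary: f)
  case 0
  note [measurable] = 0
  have "(\<integral>\<^sup>+\<omega>. f (X 0 \<omega>) \<partial>Pr x) = (\<integral>\<^sup>+y. f y \<partial>distr (Pr x) M (X 0))"
    by (intro nn_integral_distr[symmetric]) (simp_all add: measurable_law[OF x] 0)
  also have "\<dots> = f x"
    unfolding distr_initial[OF x] using x 0 by (simp add: nn_integral_return)
  finally have "(\<integral>\<^sup>+\<omega>. f (X 0 \<omega>) \<partial>Pr x) = f x" .
  moreover have "(\<integral>\<^sup>+\<omega>. indicator {\<omega> \<in> space \<Omega>. \<forall>i\<in>{1..0}. X i \<omega> \<in> D} \<omega> * f (X 0 \<omega>) \<partial>Pr x) = (\<integral>\<^sup>+\<omega>. f (X 0 \<omega>) \<partial>Pr x)"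
    using space_law[OF x] by (intro nn_integral_cong) simp
  ultimately show ?case by simp
next
  case (Suc k)
  note [measurable] = Suc.prems
  let ?H = "{\<omega> \<in> space \<Omega>. \<forall>i\<in>{1..k}. X i \<omega> \<in> D}"
  have H: "?H \<in> sets (history M \<Omega> X k)"
  proof -
    have "?H = {\<omega> \<in> space (history M \<Omega> X k). \<forall>i\<in>{1..k}. X i \<omega> \<in> D}"
      by (simp add: history_def)
    also have "\<dots> \<in> sets (history M \<Omega> X k)"
      by (intro sets.sets_Collect_finite_All measurable_sets_Collect[OF X_measurable_history]) auto
    finally show ?thesis .
  qed
  \<comment> \<open>The last step of the path is split off, not the first; this changes
    \<open>f\<close>, which is therefore arbitrary in the induction.\<close>
  have "(taboo P D ^^ Suc k) f x = (taboo P D ^^ k) (taboo P D f) x"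
    by (simp add: funpow_swap1)
  also have "\<dots> = (\<integral>\<^sup>+\<omega>. indicator ?H \<omega> * taboo P D f (X k \<omega>) \<partial>Pr x)"
    by (rule Suc.IH) simp
  also have "\<dots> = (\<integral>\<^sup>+\<omega>. indicator ?H \<omega> * (indicator D (X (Suc k) \<omega>) * f (X (Suc k) \<omega>)) \<partial>Pr x)"
    unfolding taboo_def by (intro markov_property[OF x H, symmetric]) simp
  also have "\<dots> = (\<integral>\<^sup>+\<omega>. indicator {\<omega> \<in> space \<Omega>. \<forall>i\<in>{1..Suc k}. X i \<omega> \<in> D} \<omega> * f (X (Suc k) \<omega>) \<partial>Pr x)"
    by (intro nn_integral_cong) (auto split: split_indicator simp: atLeastAtMostSuc_conv)
  finally show ?case .
qed

section \<open>The n-step kernels and the return time\<close>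

lemma sets_nstep [simp, measurable_cong]: "sets (nstep_kernel M Pr X n x) = sets M"
  by (simp add: nstep_kernel_def)

text \<open>With the whole space as \<open>D\<close> nothing is killed. This is the
  Chapman-Kolmogorov relation: the law of \<open>X n\<close> is the n-fold iterate of the one-step
  kernel.\<close>

lemma nn_integral_nstep:
  assumes x: "x \<in> space M" and f [measurable]: "f \<in> borel_measurable M"
  shows "(\<integral>\<^sup>+y. f y \<partial>nstep_kernel M Pr X n x) = (taboo P (space M) ^^ n) f x"
proof -
  have "(\<integral>\<^sup>+y. f y \<partial>nstep_kernel M Pr X n x) = (\<integral>\<^sup>+\<omega>. f (X n \<omega>) \<partial>Pr x)"
    unfolding nstep_kernel_def
    by (intro nn_integral_distr) (simp_all add: measurable_law[OF x])
  also have "\<dots> = (\<integral>\<^sup>+\<omega>. indicator {\<omega> \<in> space \<Omega>. \<forall>i\<in>{1..n}. X i \<omega> \<in> space M} \<omega> * f (X n \<omega>) \<partial>Pr x)"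
    using measurable_space[OF X_measurable]
    by (intro nn_integral_cong) (simp add: space_law[OF x])
  finally show ?thesis
    unfolding taboo_iter_eq_path_integral[OF x sets.top f] .
qed

lemma emeasure_nstep:
  assumes "x \<in> space M" "B \<in> sets M"
  shows "emeasure (nstep_kernel M Pr X n x) B = (taboo P (space M) ^^ n) (indicator B) x"
  using assms by (subst nn_integral_nstep[symmetric]) (auto simp: nstep_kernel_def)

lemma prob_space_nstep:
  assumes "x \<in> space M"
  shows "prob_space (nstep_kernel M Pr X n x)"
proof -
  interpret prob_space "Pr x" by (rule prob_space_law[OF assms])
  show ?thesis
    unfolding nstep_kernel_def by (rule prob_space_distr) (simp add: measurable_law[OF assms])
qed

text \<open>Abel summation: \<open>r\<^sup>\<tau> = 1 + (r - 1) \<Sum>\<^bsub>k<\<tau>\<^esub> r\<^sup>k\<close>.\<close>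

lemma geometric_sum_le_epow:
  assumes r: "1 < r"
  shows "1 + ennreal (r - 1) * (\<Sum>k. ennreal (r ^ k) *
      indicator {\<omega> \<in> space \<Omega>. \<forall>i\<in>{1..k}. X i \<omega> \<in> space M - C} \<omega>) \<le> epow r (return_time X C \<omega>)"
proof (cases "return_time X C \<omega>")
  case (enat n)
  \<comment> \<open>The infimum of the empty set is infinite, so a finite return time is
    attained.\<close>
  then have "{enat n | n. n \<ge> 1 \<and> X n \<omega> \<in> C} \<noteq> {}"
  proof (rule contrapos_pn)
    assume "{enat n | n. n \<ge> 1 \<and> X n \<omega> \<in> C} = {}"
    then show "return_time X C \<omega> \<noteq> enat n"
      by (simp only: return_time_def Inf_empty top_enat_def) simp
  qed
  then obtain t where "t \<in> {enat n | n. n \<ge> 1 \<and> X n \<omega> \<in> C}" by blast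
  from wellorder_InfI[OF this] have "return_time X C \<omega> \<in> {enat n | n. n \<ge> 1 \<and> X n \<omega> \<in> C}"
    by (simp only: return_time_def)
  then have n: "n \<ge> 1" "X n \<omega> \<in> C" using enat by auto
  \<comment> \<open>Terms from index \<open>n\<close> on vanish, since \<open>X n\<close> lies in
    \<open>C\<close>; the remaining indicators are merely bounded by 1.\<close>
  have "(\<Sum>k. ennreal (r ^ k) * indicator {\<omega> \<in> space \<Omega>. \<forall>i\<in>{1..k}. X i \<omega> \<in> space M - C} \<omega>) =
      (\<Sum>k<n. ennreal (r ^ k) * indicator {\<omega> \<in> space \<Omega>. \<forall>i\<in>{1..k}. X i \<omega> \<in> space M - C} \<omega>)"
    using n by (intro suminf_finite) (auto split: split_indicator)
  also have "\<dots> \<le> (\<Sum>k<n. ennreal (r ^ k))"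
    by (intro sum_mono) (auto split: split_indicator)
  also have "\<dots> = ennreal (\<Sum>k<n. r ^ k)"
    using r by (intro sum_ennreal) auto
  finally have "1 + ennreal (r - 1) * (\<Sum>k. ennreal (r ^ k) *
      indicator {\<omega> \<in> space \<Omega>. \<forall>i\<in>{1..k}. X i \<omega> \<in> space M - C} \<omega>)
      \<le> 1 + ennreal (r - 1) * ennreal (\<Sum>k<n. r ^ k)"
    by (intro add_left_mono mult_left_mono) auto
  also have "\<dots> = ennreal (1 + (r - 1) * (\<Sum>k<n. r ^ k))"
    using r by (simp add: ennreal_mult sum_nonneg)
  also have "1 + (r - 1) * (\<Sum>k<n. r ^ k) = r ^ n"
    by (simp add: power_diff_1_eq[symmetric])
  finally show ?thesis by (simp add: enat epow_def)
qed (simp add: epow_def)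

text \<open>Integrates \<open>geometric_sum_le_epow\<close> over the paths. Monotonicity of the
  integral asks nothing about measurability of the return time.\<close>

lemma resolvent_le_return_time:
  assumes x: "x \<in> space M" and C [measurable]: "C \<in> sets M" and r: "1 < r"
  shows "1 + ennreal (r - 1) * resolvent r (space M - C) x \<le> (\<integral>\<^sup>+\<omega>. epow r (return_time X C \<omega>) \<partial>Pr x)"
proof -
  interpret prob_space "Pr x" by (rule prob_space_law[OF x])
  note [measurable_cong] = sets_law[OF x]
  let ?H = "\<lambda>k. {\<omega> \<in> space \<Omega>. \<forall>i\<in>{1..k}. X i \<omega> \<in> space M - C}"
  have [measurable]: "?H k \<in> sets \<Omega>" for k by measurable
  have "(\<integral>\<^sup>+\<omega>. 1 + ennreal (r - 1) * (\<Sum>k. ennreal (r ^ k) * indicator (?H k) \<omega>) \<partial>Pr x) =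
      1 + ennreal (r - 1) * (\<Sum>k. ennreal (r ^ k) * (\<integral>\<^sup>+\<omega>. indicator (?H k) \<omega> \<partial>Pr x))"
    by (simp add: nn_integral_add nn_integral_cmult nn_integral_suminf emeasure_space_1 del: nn_integral_indicator)
  also have "(\<lambda>k. \<integral>\<^sup>+\<omega>. indicator (?H k) \<omega> \<partial>Pr x) = (\<lambda>k. (taboo P (space M - C) ^^ k) (\<lambda>_. 1) x)"
    by (intro ext, subst taboo_iter_eq_path_integral[OF x]) auto
  finally have "1 + ennreal (r - 1) * resolvent r (space M - C) x =
      (\<integral>\<^sup>+\<omega>. 1 + ennreal (r - 1) * (\<Sum>k. ennreal (r ^ k) * indicator (?H k) \<omega>) \<partial>Pr x)"
    by (simp add: resolvent_def fun_eq_iff)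
  also have "\<dots> \<le> (\<integral>\<^sup>+\<omega>. epow r (return_time X C \<omega>) \<partial>Pr x)"
    by (intro nn_integral_mono geometric_sum_le_epow[OF r])
  finally show ?thesis .
qed

section \<open>Hitting probabilities from a petite set\<close>

text \<open>Avoiding \<open>A\<close> at times 1 to \<open>N\<close> and being in \<open>A\<close>
  at time \<open>m\<close> are disjoint events.\<close>

lemma taboo_iter_add_nstep_le_one:
  assumes x: "x \<in> space M" and A [measurable]: "A \<in> sets M" and m: "1 \<le> m" "m \<le> N"
  shows "(taboo P (space M - A) ^^ N) (\<lambda>_. 1) x + emeasure (nstep_kernel M Pr X m x) A \<le> 1"
proof -
  interpret prob_space "Pr x" by (rule prob_space_law[OF x])
  note [measurable_cong] = sets_law[OF x]
  let ?H = "{\<omega> \<in> space \<Omega>. \<forall>i\<in>{1..N}. X i \<omega> \<in> space M - A}"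
  have [measurable]: "?H \<in> sets \<Omega>" by measurable
  have "(taboo P (space M - A) ^^ N) (\<lambda>_. 1) x + emeasure (nstep_kernel M Pr X m x) A =
      (\<integral>\<^sup>+\<omega>. indicator ?H \<omega> * 1 \<partial>Pr x) + (\<integral>\<^sup>+y. indicator A y \<partial>nstep_kernel M Pr X m x)"
    by (subst taboo_iter_eq_path_integral[OF x]) (auto simp: nstep_kernel_def)
  also have "(\<integral>\<^sup>+y. indicator A y \<partial>nstep_kernel M Pr X m x) = (\<integral>\<^sup>+\<omega>. indicator A (X m \<omega>) \<partial>Pr x)"
    unfolding nstep_kernel_def by (intro nn_integral_distr) measurable
  also have "(\<integral>\<^sup>+\<omega>. indicator ?H \<omega> * 1 \<partial>Pr x) + \<dots> = (\<integral>\<^sup>+\<omega>. indicator ?H \<omega> * 1 + indicator A (X m \<omega>) \<partial>Pr x)"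
    by (intro nn_integral_add[symmetric]) measurable
  also have "\<dots> \<le> (\<integral>\<^sup>+\<omega>. 1 \<partial>Pr x)"
    using m by (intro nn_integral_mono) (auto split: split_indicator)
  also have "\<dots> = 1" by (simp add: emeasure_space_1)
  finally show ?thesis .
qed

text \<open>The minorizing measure charges some set \<open>F\<close> from which \<open>A\<close> is
  reached in a fixed number of steps with probability bounded below. The sampled kernel therefore
  reaches \<open>F\<close> uniformly from \<open>C\<close>, and truncating the sampling distribution
  makes the time horizon uniform as well.\<close>

lemma petite_hitting_bound:
  assumes petite: "petite M Pr X C" and A [measurable]: "A \<in> sets M"
    and accessible: "\<And>y. y \<in> space M \<Longrightarrow> (\<Sum>n. emeasure (nstep_kernel M Pr X (Suc n) y) A) > 0"
  obtains N \<delta> where "0 < \<delta>" "\<delta> \<le> 1"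
    "\<And>x. x \<in> C \<Longrightarrow> (taboo P (space M - A) ^^ N) (\<lambda>_. 1) x \<le> ennreal (1 - \<delta>)"
proof -
  have C: "C \<in> sets M" using petite by (simp add: petite_def)
  obtain a :: "nat pmf" and \<nu> where \<nu>: "sets \<nu> = sets M" "emeasure \<nu> (space M) > 0"
    and minor_all: "\<forall>x\<in>C. \<forall>B\<in>sets M.
      emeasure \<nu> B \<le> (\<Sum>n. ennreal (pmf a n) * emeasure (nstep_kernel M Pr X n x) B)"
    using petite unfolding petite_def by blast
  then have minor: "emeasure \<nu> B \<le> (\<Sum>n. ennreal (pmf a n) * emeasure (nstep_kernel M Pr X n x) B)"
    if "x \<in> C" "B \<in> sets M" for x B
    using that by blast
  \<comment> \<open>\<open>Suc k\<close> keeps the total time at least 1 even if the sampling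
    distribution charges time 0.\<close>
  define p where "p k y = (taboo P (space M) ^^ Suc k) (indicator A) y" for k y
  have [measurable]: "p k \<in> borel_measurable M" for k
    unfolding p_def[abs_def] by measurable
  define E where "E = (\<lambda>(k, j). {y \<in> space M. ennreal (1 / real (Suc j)) \<le> p k y})"
  have E_sets: "E kj \<in> sets M" for kj
    unfolding E_def by (cases kj) simp
  have "space M \<subseteq> (\<Union>kj. E kj)"
  proof
    fix y assume y: "y \<in> space M"
    have "(\<Sum>k. p k y) > 0"
      using accessible[OF y] y by (simp add: p_def emeasure_nstep)
    have "\<exists>k. p k y \<noteq> 0"
    proof (rule ccontr)
      assume "\<nexists>k. p k y \<noteq> 0"
      then have "(\<lambda>k. p k y) = (\<lambda>_. 0)" by auto
      with \<open>(\<Sum>k. p k y) > 0\<close> show False by simp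
    qed
    then obtain k where "p k y \<noteq> 0" by blast
    then obtain e where e: "0 < e" "ennreal e \<le> p k y"
      by (cases "p k y") (auto simp: less_le intro: that[of 1])
    obtain j where "1 / real (Suc j) < e"
      using reals_Archimedean[OF e(1)] by (auto simp: inverse_eq_divide)
    then have "ennreal (1 / real (Suc j)) \<le> ennreal e" by (intro ennreal_leI) simp
    also note \<open>ennreal e \<le> p k y\<close>
    finally have "y \<in> E (k, j)" using y by (simp add: E_def)
    then show "y \<in> (\<Union>kj. E kj)" by blast
  qed
  have "\<exists>kj. emeasure \<nu> (E kj) \<noteq> 0"
  proof (rule ccontr)
    assume "\<nexists>kj. emeasure \<nu> (E kj) \<noteq> 0"
    then have "(\<Union>kj. E kj) \<in> null_sets \<nu>"
      using E_sets \<nu>(1) by (intro null_sets_UN) (auto simp: null_sets_def)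
    then have "emeasure \<nu> (space M) = 0"
      using \<open>space M \<subseteq> (\<Union>kj. E kj)\<close> \<nu>(1) by (metis null_sets_subset null_setsD1 sets.top)
    with \<nu>(2) show False by simp
  qed
  then obtain k j where kj: "emeasure \<nu> (E (k, j)) \<noteq> 0" by auto
  define F where "F = E (k, j)"
  define \<epsilon> where "\<epsilon> = 1 / real (Suc j)"
  have \<epsilon>: "0 < \<epsilon>" "\<epsilon> \<le> 1" by (auto simp: \<epsilon>_def)
  have F [measurable]: "F \<in> sets M" unfolding F_def by (rule E_sets)
  \<comment> \<open>The cap at 1 covers an infinite \<open>emeasure \<nu> F\<close>.\<close>
  obtain \<eta> where \<eta>: "0 < \<eta>" "\<eta> \<le> 1" "ennreal \<eta> \<le> emeasure \<nu> F"
  proof (cases "emeasure \<nu> F")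
    case (real e)
    then have "0 < e" using kj by (auto simp: F_def less_le)
    then show ?thesis using that[of "min 1 e"] real by (auto intro!: ennreal_leI)
  qed (use that[of 1] in simp)
  have sums_a: "pmf a sums 1"
  proof -
    have "(\<Sum>n. ennreal (pmf a n)) = 1"
      using nn_integral_pmf_eq_1[of a] by (simp add: nn_integral_count_space_nat)
    then show ?thesis
      by (intro sums_ennreal[THEN iffD1]) (auto simp: sums_iff)
  qed
  then have "(\<lambda>N. \<Sum>n<N. pmf a n) \<longlonglongrightarrow> 1" by (simp add: sums_def)
  then have "eventually (\<lambda>N. (\<Sum>n<N. pmf a n) > 1 - \<eta> / 2) sequentially"
    using \<eta> by (intro order_tendstoD) auto
  then obtain N where N: "(\<Sum>n<N. pmf a n) > 1 - \<eta> / 2"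
    by (auto simp: eventually_sequentially)
  define \<delta> where "\<delta> = \<epsilon> * (\<eta> / 2)"
  have \<delta>: "0 < \<delta>" "\<delta> \<le> 1"
    using \<epsilon> \<eta> mult_mono[of \<epsilon> 1 "\<eta> / 2" 1] by (auto simp: \<delta>_def)
  have "(taboo P (space M - A) ^^ (N + Suc k)) (\<lambda>_. 1) x \<le> ennreal (1 - \<delta>)" if xC: "x \<in> C" for x
  proof -
    have x: "x \<in> space M" using xC C sets.sets_into_space by auto
    define m where "m n = measure (nstep_kernel M Pr X n x) F" for n
    have m_eq: "emeasure (nstep_kernel M Pr X n x) F = ennreal (m n)" for n
      unfolding m_def by (intro finite_measure.emeasure_eq_measure prob_space.finite_measure prob_space_nstep x)
    have m: "0 \<le> m n" "m n \<le> 1" for n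
      unfolding m_def by (auto intro: prob_space.prob_le_1 prob_space_nstep x)
    have summable_a: "summable (pmf a)" and suminf_a: "suminf (pmf a) = 1"
      using sums_a by (auto simp: sums_iff)
    have summable_am: "summable (\<lambda>n. pmf a n * m n)"
      using m by (intro summable_comparison_test'[OF summable_a, of 0]) (auto intro: mult_left_le)
    \<comment> \<open>Otherwise the sampled mass of \<open>F\<close> is at most a tail below
      \<open>\<eta> / 2\<close> plus a head of at most \<open>\<eta> / 2\<close>. The time
      \<open>n\<close> depends on \<open>x\<close>, but \<open>N\<close> does not.\<close>
    have "\<exists>n<N. \<eta> / 2 \<le> m n"
    proof (rule ccontr)
      assume "\<not> (\<exists>n<N. \<eta> / 2 \<le> m n)"
      then have small: "m n \<le> \<eta> / 2" if "n < N" for n using that by auto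
      have "ennreal \<eta> \<le> (\<Sum>n. ennreal (pmf a n * m n))"
        using \<eta>(3) minor[OF xC F] m by (simp add: m_eq ennreal_mult)
      also have "\<dots> = ennreal (\<Sum>n. pmf a n * m n)"
        using m summable_am by (intro suminf_ennreal2) auto
      finally have "\<eta> \<le> (\<Sum>n. pmf a n * m n)"
        using m summable_am by (simp add: suminf_nonneg)
      also have "\<dots> = (\<Sum>n. pmf a (n + N) * m (n + N)) + (\<Sum>n<N. pmf a n * m n)"
        by (rule suminf_split_initial_segment[OF summable_am])
      also have "(\<Sum>n. pmf a (n + N) * m (n + N)) \<le> (\<Sum>n. pmf a (n + N))"
        using m summable_ignore_initial_segment[OF summable_am] summable_ignore_initial_segment[OF summable_a]
        by (intro suminf_le) (auto intro: mult_left_le)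
      also have "(\<Sum>n. pmf a (n + N)) = 1 - (\<Sum>n<N. pmf a n)"
        using suminf_split_initial_segment[OF summable_a, of N] suminf_a by simp
      also have "(\<Sum>n<N. pmf a n * m n) \<le> (\<Sum>n<N. pmf a n * (\<eta> / 2))"
        using small by (intro sum_mono mult_left_mono) auto
      also have "\<dots> = (\<Sum>n<N. pmf a n) * (\<eta> / 2)" by (simp add: sum_distrib_right)
      also have "(\<Sum>n<N. pmf a n) * (\<eta> / 2) \<le> 1 * (\<eta> / 2)"
        using \<eta> sum_le_suminf[OF summable_a, of "{..<N}"] suminf_a by (intro mult_right_mono) auto
      finally show False using N by simp
    qed
    then obtain n where n: "n < N" "\<eta> / 2 \<le> m n" by auto
    have "ennreal \<delta> \<le> ennreal \<epsilon> * ennreal (m n)"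
      using n \<epsilon> m by (simp add: \<delta>_def ennreal_mult[symmetric] mult_left_mono)
    also have "\<dots> = (\<integral>\<^sup>+y. ennreal \<epsilon> * indicator F y \<partial>nstep_kernel M Pr X n x)"
      by (simp add: nn_integral_cmult m_eq)
    \<comment> \<open>On \<open>F\<close> the probability of being in \<open>A\<close> after
      \<open>Suc k\<close> further steps is at least \<open>\<epsilon>\<close>.\<close>
    also have "\<dots> \<le> (\<integral>\<^sup>+y. p k y \<partial>nstep_kernel M Pr X n x)"
      by (intro nn_integral_mono) (auto simp: F_def E_def \<epsilon>_def split: split_indicator)
    also have "\<dots> = (taboo P (space M) ^^ n) (p k) x"
      by (intro nn_integral_nstep x) simp
    also have "p k = (taboo P (space M) ^^ Suc k) (indicator A)"
      by (intro ext p_def)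
    also have "(taboo P (space M) ^^ n) \<dots> x = (taboo P (space M) ^^ (n + Suc k)) (indicator A) x"
      by (simp only: funpow_add comp_apply)
    also have "\<dots> = emeasure (nstep_kernel M Pr X (n + Suc k) x) A"
      using x by (simp add: emeasure_nstep del: funpow.simps)
    finally have "(taboo P (space M - A) ^^ (N + Suc k)) (\<lambda>_. 1) x + ennreal \<delta> \<le> 1"
      using n by (intro order.trans[OF add_left_mono taboo_iter_add_nstep_le_one[OF x A]]) auto
    also have "1 = ennreal (1 - \<delta>) + ennreal \<delta>"
      using \<delta> by (simp flip: ennreal_plus)
    finally show ?thesis
      by (simp add: add.commute[of _ "ennreal \<delta>"] ennreal_add_left_cancel_le)
  qed
  with \<delta> show ?thesis by (rule that)
qed

section \<open>A contracted function from geometric ergodicity\<close>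

text \<open>The last conclusion cannot come from contraction alone, as \<open>U\<close> may be
  infinite. It follows from a start in \<open>C\<close>: some n-step law charges \<open>B\<close>,
  and w is finite almost everywhere under that law.\<close>

lemma geometrically_ergodic_imp_contraction:
  assumes ergodic: "geometrically_ergodic M Pr X" and irr: "irreducibility_measure M Pr X \<psi>"
    and A: "A \<in> Bplus M \<psi>"
  obtains U q where "U \<in> borel_measurable M" "0 < q" "q < 1"
    "\<And>x. 1 \<le> U x" "\<And>x. x \<in> space M \<Longrightarrow> taboo P (space M - A) U x \<le> ennreal q * U x"
    "\<And>B. B \<in> Bplus M \<psi> \<Longrightarrow> \<exists>y\<in>B. U y < \<top>"
proof -
  obtain C r where C: "C \<noteq> {}" "petite M Pr X C" and r: "1 < r"
    and sup: "(SUP x\<in>C. \<integral>\<^sup>+\<omega>. epow r (return_time X C \<omega>) \<partial>Pr x) < \<infinity>"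
    using ergodic by (auto simp: geometrically_ergodic_def)
  have [measurable]: "C \<in> sets M" using C by (simp add: petite_def)
  have C_sub: "x \<in> space M" if "x \<in> C" for x
    using that sets.sets_into_space[OF \<open>C \<in> sets M\<close>] by auto
  have [measurable]: "A \<in> sets M" using A by (simp add: Bplus_def)
  obtain L where L: "0 \<le> L" "(SUP x\<in>C. \<integral>\<^sup>+\<omega>. epow r (return_time X C \<omega>) \<partial>Pr x) = ennreal L"
    using sup by (cases "SUP x\<in>C. \<integral>\<^sup>+\<omega>. epow r (return_time X C \<omega>) \<partial>Pr x") auto
  have bound: "1 + ennreal (r - 1) * resolvent r (space M - C) x \<le> ennreal L" if "x \<in> C" for x
  proof -
    have "1 + ennreal (r - 1) * resolvent r (space M - C) x \<le> (\<integral>\<^sup>+\<omega>. epow r (return_time X C \<omega>) \<partial>Pr x)"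
      using r by (intro resolvent_le_return_time C_sub that) auto
    also have "\<dots> \<le> ennreal L" unfolding L(2)[symmetric] using that by (intro SUP_upper)
    finally show ?thesis .
  qed
  have accessible: "(\<Sum>n. emeasure (nstep_kernel M Pr X (Suc n) x) B) > 0"
    if "B \<in> Bplus M \<psi>" "x \<in> space M" for B x
    using irr that by (simp add: irreducibility_measure_def Bplus_def)
  obtain N \<delta> where N: "0 < \<delta>" "\<delta> \<le> 1"
      "\<And>x. x \<in> C \<Longrightarrow> (taboo P (space M - A) ^^ N) (\<lambda>_. 1) x \<le> ennreal (1 - \<delta>)"
    using petite_hitting_bound[OF C(2) \<open>A \<in> sets M\<close> accessible[OF A]] by blast
  obtain U q where U: "U \<in> borel_measurable M" "0 < q" "q < 1"
    "\<And>x. 1 \<le> U x" "\<And>x. x \<in> space M \<Longrightarrow> taboo P (space M - A) U x \<le> ennreal q * U x"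
    "\<And>x. x \<in> space M \<Longrightarrow> lyapunov r C x < \<top> \<Longrightarrow> U x < \<top>"
  proof (rule taboo_contraction_exists[of C "space M - A" r \<delta> L N])
  qed (use r N L bound in auto)
  have "\<exists>y\<in>B. U y < \<top>" if B: "B \<in> Bplus M \<psi>" for B
  proof -
    obtain x where "x \<in> C" using C by auto
    then have x: "x \<in> space M" by (rule C_sub)
    have [measurable]: "B \<in> sets M" using B by (simp add: Bplus_def)
    have "\<exists>n. emeasure (nstep_kernel M Pr X (Suc n) x) B \<noteq> 0"
    proof (rule ccontr)
      assume "\<nexists>n. emeasure (nstep_kernel M Pr X (Suc n) x) B \<noteq> 0"
      then have "(\<lambda>n. emeasure (nstep_kernel M Pr X (Suc n) x) B) = (\<lambda>_. 0)" by auto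
      with accessible[OF B x] show False by simp
    qed
    then obtain n where n: "emeasure (nstep_kernel M Pr X n x) B \<noteq> 0" by blast
    have "lyapunov r C x \<le> 1 + ennreal (r - 1) * resolvent r (space M - C) x"
      using \<open>x \<in> C\<close> by (simp add: lyapunov_def)
    also have "\<dots> \<le> ennreal L" by (rule bound[OF \<open>x \<in> C\<close>])
    finally have "lyapunov r C x \<le> ennreal L" .
    then have "lyapunov r C x + ennreal (real n * L) < \<top>"
      by (auto simp: top.not_eq_extremum[symmetric] top_unique)
    have "(\<integral>\<^sup>+y. lyapunov r C y \<partial>nstep_kernel M Pr X n x) \<le> lyapunov r C x + ennreal (real n * L)"
      unfolding nn_integral_nstep[OF x lyapunov_measurable[OF \<open>C \<in> sets M\<close>]]
      using r L x bound by (intro lyapunov_iter_finite) auto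
    then have "(\<integral>\<^sup>+y. lyapunov r C y \<partial>nstep_kernel M Pr X n x) \<noteq> \<infinity>"
      using \<open>lyapunov r C x + ennreal (real n * L) < \<top>\<close> by (auto simp: top_unique)
    then have fin: "AE y in nstep_kernel M Pr X n x. lyapunov r C y \<noteq> \<infinity>"
      by (intro nn_integral_PInf_AE) (auto simp: nstep_kernel_def)
    show ?thesis
    proof (rule ccontr)
      assume "\<not> (\<exists>y\<in>B. U y < \<top>)"
      \<comment> \<open>If \<open>U\<close> is infinite throughout \<open>B\<close>, so is w, which
        forces the n-step law to give \<open>B\<close> mass 0.\<close>
      then have *: "lyapunov r C y = \<top>" if "y \<in> B" for y
        using U(6)[of y] that sets.sets_into_space[OF \<open>B \<in> sets M\<close>]
        by (metis subsetD top.not_eq_extremum)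
      have "AE y in nstep_kernel M Pr X n x. y \<notin> B"
        using fin by eventually_elim (auto dest: *)
      then have "emeasure (nstep_kernel M Pr X n x) B = 0"
        by (subst (asm) AE_iff_measurable[of B]) (auto simp: nstep_kernel_def dest: sets.sets_into_space[OF \<open>B \<in> sets M\<close>, THEN subsetD])
      with n show False by simp
    qed
  qed
  with U show ?thesis by (intro that[of U q]) auto
qed

end

section \<open>Boundedness of the subsolutions at a single point\<close>

theorem theorem1p7:
  fixes M :: "'a::metric_space measure"
    and \<Omega> :: "'w measure"
    and Pr :: "'a \<Rightarrow> 'w measure"
    and X :: "nat \<Rightarrow> 'w \<Rightarrow> 'a"
    and \<psi> :: "'a measure"
    and A :: "'a set"
    and r :: "nat \<Rightarrow> real"
    and V :: "nat \<Rightarrow> 'a \<Rightarrow> real"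
  assumes "locally_compact_space (euclidean :: 'a topology)"
    and "separable_space (euclidean :: 'a topology)"
    and "space M = UNIV"
    and "countably_generated_sigma_field M"
    and "markov_chain M \<Omega> Pr X"
    and "maximal_irreducibility_measure M Pr X \<psi>"
    and "aperiodic M Pr X \<psi>"
    and "harris_recurrent M Pr X \<psi>"
    and "A \<in> Bplus M \<psi>"
    and "\<And>n. n \<ge> 1 \<Longrightarrow> r n > 1"
    and "\<And>n. n \<ge> 1 \<Longrightarrow> V n \<in> borel_measurable M"
    and "r \<longlonglongrightarrow> 1"
    and "\<And>n. n \<ge> 1 \<Longrightarrow> compact (closure {x. V n x \<noteq> 0})"
    and "\<And>n K. n \<ge> 1 \<Longrightarrow> compact K \<Longrightarrow> bounded (V n ` K)"
    and "\<And>n x. n \<ge> 1 \<Longrightarrow>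
           V n x \<le> r n * (LINT y:(-A)|nstep_kernel M Pr X 1 x. V n y) + 1"
    and "{x. (SUP n\<in>{1..}. ereal (V n x)) = \<infinity>} \<in> Bplus M \<psi>"
  shows "\<not> geometrically_ergodic M Pr X"
proof
  have space: "space M = UNIV" by (rule assms(3))
  define P where "P = nstep_kernel M Pr X 1"
  interpret markov_process M \<Omega> Pr X P
    using assms(5) by unfold_locales (simp_all add: P_def)
  assume "geometrically_ergodic M Pr X"
  moreover have "irreducibility_measure M Pr X \<psi>"
    using assms(6) by (simp add: maximal_irreducibility_measure_def)
  ultimately obtain U q where U_meas [measurable]: "U \<in> borel_measurable M" and q: "0 < q" "q < 1"
    and U: "\<And>x. 1 \<le> U x" "\<And>x. x \<in> space M \<Longrightarrow> taboo P (space M - A) U x \<le> ennreal q * U x"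
    and fin: "\<And>B. B \<in> Bplus M \<psi> \<Longrightarrow> \<exists>y\<in>B. U y < \<top>"
    using assms(9) by (rule geometrically_ergodic_imp_contraction) blast
  \<comment> \<open>The contradiction takes place at this one point of the set where the supremum is
    infinite.\<close>
  obtain y where y: "(SUP n\<in>{1..}. ereal (V n y)) = \<infinity>" "U y < \<top>"
    using fin[OF assms(16)] by auto
  obtain u where u: "0 \<le> u" "U y = ennreal u"
    using y(2) by (cases "U y") auto
  have A [measurable]: "A \<in> sets M" using assms(9) by (simp add: Bplus_def)
  \<comment> \<open>Any number strictly between \<open>q\<close> and 1 serves:
    \<open>r n * q\<close> tends to \<open>q\<close>, so it is eventually below \<open>s\<close> and
    the bound becomes uniform in n.\<close>
  define s where "s = (1 + q) / 2"
  have s: "q < s" "s < 1" using q by (auto simp: s_def)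
  have "(\<lambda>n. r n * q) \<longlonglongrightarrow> 1 * q"
    by (intro tendsto_intros assms(12))
  then have "eventually (\<lambda>n. r n * q < s) sequentially"
    using s by (intro order_tendstoD) auto
  then obtain n0 where n0: "\<And>n. n \<ge> n0 \<Longrightarrow> r n * q < s"
    by (auto simp: eventually_sequentially)
  have tail: "V n y \<le> 1 / (1 - s) * u" if n: "n \<ge> 1" "n \<ge> n0" for n
  proof -
    have "bounded (V n ` closure {x. V n x \<noteq> 0})"
      using n by (intro assms(13,14))
    then obtain b where b: "\<And>x. x \<in> closure {x. V n x \<noteq> 0} \<Longrightarrow> \<bar>V n x\<bar> \<le> b"
      by (auto simp: bounded_iff)
    \<comment> \<open>The 0 covers points off the support, and also a negative \<open>b\<close>,
      which can occur when the support is empty.\<close>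
    have V_le: "V n x \<le> max b 0" for x
      using b[of x] closure_subset[of "{x. V n x \<noteq> 0}"] by (cases "V n x = 0") (auto simp: subset_iff)
    have sub: "ennreal (V n x) \<le> ennreal (r n) * taboo P (space M - A) (\<lambda>z. ennreal (V n z)) x + 1" for x
    proof -
      define I where "I = (LINT z:(-A)|P x. V n z)"
      have rn: "0 \<le> r n" using assms(10)[OF n(1)] by simp
      have "ennreal I \<le> (\<integral>\<^sup>+z. ennreal (indicator (-A) z *\<^sub>R V n z) \<partial>P x)"
        unfolding I_def set_lebesgue_integral_def by (rule ennreal_integral_le_nn_integral)
      also have "\<dots> = taboo P (space M - A) (\<lambda>z. ennreal (V n z)) x"
        unfolding taboo_def by (intro nn_integral_cong) (auto simp: space split: split_indicator)
      finally have I: "ennreal I \<le> taboo P (space M - A) (\<lambda>z. ennreal (V n z)) x" .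
      have "ennreal (V n x) \<le> ennreal (r n * I + 1)"
        using assms(15)[OF n(1), of x] by (intro ennreal_leI) (simp add: I_def P_def)
      \<comment> \<open>\<open>I\<close> may be negative; truncating it at 0 lets
        \<open>ennreal\<close> split over the product and the sum.\<close>
      also have "\<dots> \<le> ennreal (r n * max I 0 + 1)"
        using rn by (intro ennreal_leI add_right_mono mult_left_mono) auto
      also have "\<dots> = ennreal (r n) * ennreal I + 1"
        using rn by (auto simp: ennreal_mult max_def ennreal_neg)
      also have "\<dots> \<le> ennreal (r n) * taboo P (space M - A) (\<lambda>z. ennreal (V n z)) x + 1"
        using I by (intro add_right_mono mult_left_mono) auto
      finally show ?thesis .
    qed
    have rq: "r n * q < s" using n0 n by auto
    have "ennreal (V n y) \<le> ennreal (1 / (1 - r n * q)) * U y"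
    proof (rule subsolution_le)
      show "space M - A \<in> sets M" by simp
      show "ennreal (V n x) \<le> ennreal (max b 0)" for x by (intro ennreal_leI V_le)
    qed (use U q sub rq s assms(10)[OF n(1)] space in auto)
    also have "\<dots> \<le> ennreal (1 / (1 - s)) * U y"
      using rq s by (intro mult_right_mono ennreal_leI) (auto simp: frac_le)
    also have "\<dots> = ennreal (1 / (1 - s) * u)"
      unfolding u(2) using u(1) s by (intro ennreal_mult[symmetric]) auto
    finally show ?thesis using u s by (simp add: ennreal_le_iff)
  qed
  \<comment> \<open>The maximum takes care of the finitely many indices below \<open>n0\<close>,
    where \<open>r n * q < s\<close> may fail; including index 0 can only raise it.\<close>
  define m where "m = max (1 / (1 - s) * u) (Max ((\<lambda>n. V n y) ` {..n0}))"
  have "V n y \<le> m" if "n \<ge> 1" for n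
  proof (cases "n \<ge> n0")
    case True
    then show ?thesis using tail[OF that] by (simp add: m_def)
  next
    case False
    then have "V n y \<le> Max ((\<lambda>n. V n y) ` {..n0})" by (intro Max_ge) auto
    then show ?thesis by (simp add: m_def)
  qed
  then have "(SUP n\<in>{1..}. ereal (V n y)) \<le> ereal m"
    by (intro SUP_least) auto
  with y(1) show False by simp
qed

end
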